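(* Consider the risk-adjustable distributionally robust chance-constrained problem $$\min_{x\in\mathcal X,\ \alpha\in[0,\bar\alpha]}\Big\{c^\top x+g(\alpha):\ \inf_{f\in\mathcal D}\mathbb P_f(Tx\ge\xi)\ge1-\alpha\Big\}.$$ Under the continuous distribution assumption, and under the assumption that for an optimal solution $\hat x$ one has $T\hat x\ge\xi^N$ (the optimal solution is restricted by the smallest realization of $\xi$), this problem is equivalent to the following mixed 0-1 conic formulation: $$\begin{aligned} z^c=\min_{x\in\mathcal X,\,o,\,\alpha,\,u,\,w}\quad & c^\top x+g(\alpha)\\ \text{s.t.}\quad & uw\ge\sum_{j=0}^{N-1}\sum_{k=j}^{N-1}o_{jk}\sum_{i=j+1}^{k}(\xi^i-\xi^{k+1})+N\epsilon,\\ & u\le\alpha N-\sum_{j=0}^{N-1}\sum_{k=j}^{N-1}j\,o_{jk},\\ & w\le Tx-\sum_{j=0}^{N-1}\sum_{k=j}^{N-1}\xi^{k+1}o_{jk},\\ & \sum_{j=0}^{N-1}\sum_{k=j}^{N-1}\xi^jo_{jk}\ge Tx\ge\sum_{j=0}^{N-1}\sum_{k=j}^{N-1}\xi^{j+1}o_{jk},\\ & \sum_{j=0}^{N-1}\sum_{k=j}^{N-1}(k+1)o_{jk}\ge\alpha N\ge\sum_{j=0}^{N-1}\sum_{k=j}^{N-1}k\,o_{jk},\\ & \sum_{j=0}^{N-1}\sum_{k=j}^{N-1}o_{jk}=1,\\ & \alpha\in(0,\bar\alpha],\quad w\ge0,\ u\ge0,\\ & o_{jk}\in\{0,1\},\quad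 0\le j\le k\le N-1.\end{aligned}$$
   Context: Data: $\mathcal X\subset\mathbb R^d$, $c\in\mathbb R^d$, a fixed row vector $T\in\mathbb R^d$, an upper bound $\bar\alpha\in(0,1)$ on the risk tolerance $\alpha$, and a monotonically increasing risk cost function $g:[0,\bar\alpha]\to[0,\infty)$. The scalar random variable $\xi$ has $N$ samples ordered $\xi^1\ge\xi^2\ge\dots\ge\xi^N$, and $\xi^0$ denotes an upper bound of $\xi$. For a radius $\epsilon>0$, $\mathcal D$ is the set of probability distributions on $\mathbb R$ within 1-Wasserstein distance $\epsilon$ (ground metric $|\cdot|$) of the empirical distribution giving mass $1/N$ to each sample. Continuous distribution assumption: $\xi$ has a continuum (infinite number) of realizations and the probability of every single realization is zero. For a given $\alpha$, the chance constraint $\inf_{f\in\mathcal D}\mathbb P_f(Tx\ge\xi)\ge1-\alpha$ is then equivalent (a known result) to $$\sum_{n=1}^{\alpha N}(Tx-\xi^n)^+\ge N\epsilon,$$ where $(a)^+=\max\{a,0\}$ and for fractional $\alpha N$ the sum is the partial sum $\sum_{n=1}^{\alpha N}k_n:=\sum_{n=1}^{\lfloor\alpha N\rfloor}k_n+(\alpha N-\lfloor\alpha N\rfloor)k_{\lfloor\alpha N\rfloor+1}$. The binary variable $o_{jk}$ indicates whether $k=\lfloor\alpha N\rfloor$ and $j$ is the smallest index such that $Tx-\xi^{j+1}\ge0$.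
   Formalization: The claim fails if every optimal solution has Tx > ξ^0, since the 0-1 formulation forces Tx ≤ ξ^0; it is therefore also assumed that some optimal solution satisfies Tx ≤ ξ^0, and feasible and optimal solutions are matched among points with Tx ≤ ξ^0. *)

theory Defs
  imports "HOL-Probability.Probability"
begin

definition couplings :: "real measure \<Rightarrow> real measure \<Rightarrow> (real \<times> real) measure set" where
  "couplings \<mu> \<nu> =
     {\<pi>. sets \<pi> = sets borel \<and> distr \<pi> borel fst = \<mu> \<and> distr \<pi> borel snd = \<nu>}"

definition wasserstein1 :: "real measure \<Rightarrow> real measure \<Rightarrow> ennreal" where
  "wasserstein1 \<mu> \<nu> = (INF \<pi>\<in>couplings \<mu> \<nu>. \<integral>\<^sup>+ z. ennreal \<bar>fst z - snd z\<bar> \<partial>\<pi>)"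

definition wasserstein_ball :: "real \<Rightarrow> real measure \<Rightarrow> real measure set" where
  "wasserstein_ball \<epsilon> \<nu> =
     {f. prob_space f \<and> sets f = sets borel \<and> wasserstein1 f \<nu> \<le> ennreal \<epsilon>}"

text \<open>
  The continuous distribution assumption can be read in two ways: the ambiguity set is the whole
  Wasserstein ball, or it is the part of the ball whose members give every single realization
  probability zero. In the second case its centre, a discrete measure, is not itself a member.
\<close>

definition atomless :: "real measure \<Rightarrow> bool" where
  "atomless f \<longleftrightarrow> (\<forall>a. measure f {a} = 0)"

text \<open>
  Throughout, \<open>\<xi> 1, \<dots>, \<xi> N\<close> are the ordered samples and \<open>\<xi> 0\<close> is the upper bound. Values
  \<open>\<xi> n\<close> with \<open>n > N\<close> are never used. The image measure below gives a value that occurs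
  several times among the samples the corresponding multiple of \<open>1/N\<close>.
\<close>

definition empirical :: "nat \<Rightarrow> (nat \<Rightarrow> real) \<Rightarrow> real measure" where
  "empirical N \<xi> = distr (measure_pmf (pmf_of_set {1..N})) borel \<xi>"

definition risk_cost :: "real ^ 'd \<Rightarrow> (real \<Rightarrow> real) \<Rightarrow> real ^ 'd \<Rightarrow> real \<Rightarrow> real" where
  "risk_cost c g x \<alpha> = c \<bullet> x + g \<alpha>"

definition drcc_feasible ::
  "(real ^ 'd) set \<Rightarrow> real ^ 'd \<Rightarrow> real \<Rightarrow> real measure set \<Rightarrow> real ^ 'd \<Rightarrow> real \<Rightarrow> bool" where
  "drcc_feasible X T \<alpha>max D x \<alpha> \<longleftrightarrow>
     x \<in> X \<and> \<alpha> \<in> {0..\<alpha>max} \<and> (INF f\<in>D. measure f {y. T \<bullet> x \<ge> y}) \<ge> 1 - \<alpha>"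

text \<open>
  Only the entries \<open>ob j k\<close> with \<open>j \<le> k < N\<close> of the binary array are constrained or used.
  The entry equal to 1 stands for \<open>k = \<lfloor>\<alpha> N\<rfloor>\<close> and \<open>j\<close> the least index with \<open>T \<bullet> x \<ge> \<xi> (j+1)\<close>;
  ties are allowed on the breakpoints \<open>\<alpha> N = k+1\<close> and \<open>T \<bullet> x = \<xi> j\<close>. The first inequality then
  expresses \<open>(\<alpha> N - j) (T \<bullet> x - \<xi> (k+1)) \<ge> (\<Sum>i=j+1..k. \<xi> i - \<xi> (k+1)) + N \<epsilon>\<close>, a rearrangement of
  the partial sum of the positive parts of \<open>T \<bullet> x - \<xi> n\<close>, \<open>n \<le> \<alpha> N\<close>, being at least \<open>N \<epsilon>\<close>.
  For \<open>j = 0\<close> the constraint \<open>T \<bullet> x \<le> \<xi> j\<close> makes \<open>\<xi> 0\<close> an upper bound on \<open>T \<bullet> x\<close> as well.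
\<close>

definition micp_feasible ::
  "(real ^ 'd) set \<Rightarrow> real ^ 'd \<Rightarrow> real \<Rightarrow> nat \<Rightarrow> (nat \<Rightarrow> real) \<Rightarrow> real \<Rightarrow>
   real ^ 'd \<Rightarrow> (nat \<Rightarrow> nat \<Rightarrow> real) \<Rightarrow> real \<Rightarrow> real \<Rightarrow> real \<Rightarrow> bool" where
  "micp_feasible X T \<alpha>max N \<xi> \<epsilon> x ob \<alpha> u w \<longleftrightarrow>
     x \<in> X \<and>
     u * w \<ge> (\<Sum>j<N. \<Sum>k=j..<N. ob j k * (\<Sum>i=j+1..k. (\<xi> i - \<xi> (k+1)))) + real N * \<epsilon> \<and>
     u \<le> \<alpha> * real N - (\<Sum>j<N. \<Sum>k=j..<N. real j * ob j k) \<and>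
     w \<le> T \<bullet> x - (\<Sum>j<N. \<Sum>k=j..<N. \<xi> (k+1) * ob j k) \<and>
     (\<Sum>j<N. \<Sum>k=j..<N. \<xi> j * ob j k) \<ge> T \<bullet> x \<and>
     T \<bullet> x \<ge> (\<Sum>j<N. \<Sum>k=j..<N. \<xi> (j+1) * ob j k) \<and>
     (\<Sum>j<N. \<Sum>k=j..<N. (real k + 1) * ob j k) \<ge> \<alpha> * real N \<and>
     \<alpha> * real N \<ge> (\<Sum>j<N. \<Sum>k=j..<N. real k * ob j k) \<and>
     (\<Sum>j<N. \<Sum>k=j..<N. ob j k) = 1 \<and>
     \<alpha> \<in> {0<..\<alpha>max} \<and> w \<ge> 0 \<and> u \<ge> 0 \<and>
     (\<forall>j<N. \<forall>k\<in>{j..<N}. ob j k \<in> {0, 1})"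

definition drcc_optimal ::
  "(real ^ 'd) set \<Rightarrow> real ^ 'd \<Rightarrow> real ^ 'd \<Rightarrow> (real \<Rightarrow> real) \<Rightarrow> real \<Rightarrow> real measure set \<Rightarrow>
   real ^ 'd \<Rightarrow> real \<Rightarrow> bool" where
  "drcc_optimal X T c g \<alpha>max D x \<alpha> \<longleftrightarrow>
     is_arg_min (\<lambda>(x, \<alpha>). risk_cost c g x \<alpha>) (\<lambda>(x, \<alpha>). drcc_feasible X T \<alpha>max D x \<alpha>) (x, \<alpha>)"

definition micp_optimal ::
  "(real ^ 'd) set \<Rightarrow> real ^ 'd \<Rightarrow> real ^ 'd \<Rightarrow> (real \<Rightarrow> real) \<Rightarrow> real \<Rightarrow> nat \<Rightarrow> (nat \<Rightarrow> real) \<Rightarrow>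
   real \<Rightarrow> real ^ 'd \<Rightarrow> (nat \<Rightarrow> nat \<Rightarrow> real) \<Rightarrow> real \<Rightarrow> real \<Rightarrow> real \<Rightarrow> bool" where
  "micp_optimal X T c g \<alpha>max N \<xi> \<epsilon> x ob \<alpha> u w \<longleftrightarrow>
     is_arg_min (\<lambda>(x, ob, \<alpha>, u, w). risk_cost c g x \<alpha>)
       (\<lambda>(x, ob, \<alpha>, u, w). micp_feasible X T \<alpha>max N \<xi> \<epsilon> x ob \<alpha> u w) (x, ob, \<alpha>, u, w)"

text \<open>Optimal values are extended reals; an infeasible problem has value \<open>\<infinity>\<close>.\<close>

definition drcc_value ::
  "(real ^ 'd) set \<Rightarrow> real ^ 'd \<Rightarrow> real ^ 'd \<Rightarrow> (real \<Rightarrow> real) \<Rightarrow> real \<Rightarrow> real measure set \<Rightarrow> ereal"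
  where
  "drcc_value X T c g \<alpha>max D =
     Inf {ereal (risk_cost c g x \<alpha>) | x \<alpha>. drcc_feasible X T \<alpha>max D x \<alpha>}"

definition micp_value ::
  "(real ^ 'd) set \<Rightarrow> real ^ 'd \<Rightarrow> real ^ 'd \<Rightarrow> (real \<Rightarrow> real) \<Rightarrow> real \<Rightarrow> nat \<Rightarrow> (nat \<Rightarrow> real) \<Rightarrow>
   real \<Rightarrow> ereal" where
  "micp_value X T c g \<alpha>max N \<xi> \<epsilon> =
     Inf {ereal (risk_cost c g x \<alpha>) | x ob \<alpha> u w. micp_feasible X T \<alpha>max N \<xi> \<epsilon> x ob \<alpha> u w}"

end

theory Submission
  imports Defs
begin

text \<open>
  Write \<open>t = T \<bullet> x\<close>. Violating the constraint means putting mass on the open half-line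
  \<open>{t<..}\<close>, and the distance of the sample \<open>\<xi> n\<close> from it is \<open>(t - \<xi> n)\<^sup>+\<close>, which increases with
  \<open>n\<close>. The cheapest way to move a fraction \<open>\<alpha>\<close> of the empirical mass there starts with the
  largest samples and costs \<open>1/N\<close> times the partial sum of these distances up to \<open>\<alpha> N\<close>. So the
  chance constraint should say that this cost is at least \<open>\<epsilon>\<close>
  (\<open>chance_constraint_iff_partial_sum\<close>).

  If the cost is at least \<open>\<epsilon>\<close>, linear programming duality gives the bound: the distance of the
  last sample touched is a price \<open>l\<close> per unit of violating mass, and any coupling with the
  empirical distribution pays at least what this price predicts
  (\<open>wasserstein_ball_tail_bound\<close>, \<open>partial_sum_dual\<close>). The price is positive because
  \<open>\<epsilon> > 0\<close>, so a violation probability above \<open>\<alpha>\<close> would exceed the budget strictly.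
  If the cost is below \<open>\<epsilon>\<close>, the slack pays for moving slightly more than the fraction \<open>\<alpha>\<close>,
  slightly beyond \<open>t\<close>, and for smearing every atom into an interval
  (\<open>wasserstein_ball_transport\<close>). The resulting distribution has no atoms, so the same
  criterion holds whether the ambiguity set is the whole ball or only its atomless part.

  It remains to describe the partial sum by finitely many algebraic cases. Let \<open>j\<close> and \<open>k\<close> record
  in which interval \<open>[\<xi> (j+1), \<xi> j]\<close> the number \<open>t\<close> lies and in which interval \<open>[k, k+1]\<close> the
  number \<open>\<alpha> N\<close> lies. In such a cell the positive parts disappear and the partial sum is the product
  \<open>(\<alpha> N - j) (t - \<xi> (k+1))\<close> minus a constant (\<open>partial_sum_cell\<close>). The one-hot array selects the
  cell, and \<open>u\<close> and \<open>w\<close> are lower bounds on the two nonnegative factors, best chosen equal to them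
  (\<open>micp_feasible_iff_cell\<close>). A positive partial sum together with \<open>t \<le> \<xi> 0\<close> forces
  some cell to exist (\<open>cell_exists\<close>).

  Hence the feasible pairs \<open>(x, \<alpha>)\<close> of the mixed-integer problem are exactly those of the
  chance-constrained problem that satisfy \<open>T \<bullet> x \<le> \<xi> 0\<close>. Since some optimal solution
  satisfies this extra bound, if there is a feasible one at all, imposing it changes neither the
  optimal value nor the optimality of the solutions that obey it.
\<close>

section \<open>Partial sums with a fractional upper limit\<close>

definition partial_sum :: "(nat \<Rightarrow> real) \<Rightarrow> real \<Rightarrow> real" where
  "partial_sum a r = (\<Sum>n=1..nat \<lfloor>r\<rfloor>. a n) + (r - \<lfloor>r\<rfloor>) * a (nat \<lfloor>r\<rfloor> + 1)"

text \<open>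
  At an integer \<open>r = k + 1\<close> the two adjacent linear pieces agree. This closed form of the interval
  \<open>[k, k + 1]\<close> is what makes the tie at the breakpoints of \<open>\<alpha> N\<close> harmless.
\<close>

lemma partial_sum_eq:
  assumes "real k \<le> r" "r \<le> real k + 1"
  shows "partial_sum a r = (\<Sum>n=1..k. a n) + (r - real k) * a (k + 1)"
proof (cases "r = real k + 1")
  case True
  then have "\<lfloor>r\<rfloor> = int k + 1" by simp
  then have "nat \<lfloor>r\<rfloor> = Suc k" "real_of_int \<lfloor>r\<rfloor> = r" using True by auto
  then show ?thesis using True by (simp add: partial_sum_def)
next
  case False
  then have "\<lfloor>r\<rfloor> = int k" using assms by (simp add: floor_eq_iff)
  then show ?thesis by (simp add: partial_sum_def)
qed

text \<open>
  The partial sum is the minimum of \<open>\<Sum>n. p n * a n\<close> over weights \<open>0 \<le> p n \<le> 1\<close> of total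
  \<open>r\<close>. The right-hand side is the objective of the dual linear program at \<open>l\<close>, the cost of the
  term at which the budget \<open>r\<close> runs out; there the duality gap vanishes.
\<close>

lemma partial_sum_dual:
  assumes "mono_on {1..N} a" "0 \<le> r" "r < real N"
  defines "l \<equiv> a (nat \<lfloor>r\<rfloor> + 1)"
  shows "partial_sum a r = l * r - (\<Sum>n=1..N. max 0 (l - a n))"
proof -
  define k where "k = nat \<lfloor>r\<rfloor>"
  have k: "real k \<le> r" "r \<le> real k + 1" "k < N"
    using assms(2,3) unfolding k_def by linarith+
  have m: "a m \<le> a n" if "1 \<le> m" "m \<le> n" "n \<le> N" for m n
    using that by (intro mono_onD[OF assms(1)]) auto
  have "(\<Sum>n=1..N. max 0 (l - a n)) = (\<Sum>n=1..k. l - a n)"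
  proof (rule sum.mono_neutral_cong_right)
    show "\<forall>n\<in>{1..N} - {1..k}. max 0 (l - a n) = 0"
    proof
      fix n assume "n \<in> {1..N} - {1..k}"
      then show "max 0 (l - a n) = 0"
        using m[of "k+1" n] unfolding l_def k_def[symmetric] by auto
    qed
    show "max 0 (l - a n) = l - a n" if "n \<in> {1..k}" for n
      using that k m[of n "k+1"] unfolding l_def k_def[symmetric] by auto
  qed (use k in auto)
  also have "\<dots> = l * k - (\<Sum>n=1..k. a n)"
    by (simp add: sum_subtractf)
  finally show ?thesis
    using partial_sum_eq[OF k(1,2), of a] unfolding l_def k_def[symmetric]
    by (simp add: algebra_simps)
qed

section \<open>Tail probabilities in a Wasserstein ball around the empirical distribution\<close>

lemma nn_integral_empirical:
  assumes "1 \<le> N" and [measurable]: "h \<in> borel_measurable borel" and "\<And>y. 0 \<le> h y"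
  shows "(\<integral>\<^sup>+ s. ennreal (h s) \<partial>empirical N \<xi>) = ennreal ((\<Sum>n=1..N. h (\<xi> n)) / N)"
proof -
  have "(\<integral>\<^sup>+ s. ennreal (h s) \<partial>empirical N \<xi>)
      = (\<integral>\<^sup>+ n. ennreal (h (\<xi> n)) \<partial>measure_pmf (pmf_of_set {1..N}))"
    unfolding empirical_def by (subst nn_integral_distr) auto
  also have "\<dots> = ennreal ((\<Sum>n=1..N. h (\<xi> n)) / N)"
    using assms(1,3)
    by (subst nn_integral_pmf_of_set)
       (auto simp: sum_nonneg sum_ennreal divide_ennreal ennreal_of_nat_eq_real_of_nat)
  finally show ?thesis .
qed

text \<open>
  Weak duality for the worst-case tail probability. If a unit of mass at \<open>s\<close> is moved to
  \<open>y > t\<close>, it travels at least \<open>(t - s)\<^sup>+\<close>, so \<open>l \<le> \<bar>y - s\<bar> + (l - (t - s)\<^sup>+)\<^sup>+\<close>. Integrating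
  this against a coupling bounds its cost from below by a quantity that depends only on the two
  marginals, so the bound passes to the infimum over couplings.
\<close>

lemma wasserstein_ball_tail_bound:
  assumes "f \<in> wasserstein_ball \<epsilon> (empirical N \<xi>)" "1 \<le> N" "0 \<le> \<epsilon>" "0 \<le> l"
  shows "l * measure f {t<..} - (\<Sum>n=1..N. max 0 (l - max 0 (t - \<xi> n))) / N \<le> \<epsilon>"
proof -
  define c where "c = (\<Sum>n=1..N. max 0 (l - max 0 (t - \<xi> n))) / N"
  have c0: "0 \<le> c" unfolding c_def by (auto intro!: sum_nonneg divide_nonneg_nonneg)
  have f: "prob_space f" and sf [measurable_cong]: "sets f = sets borel"
    and W: "wasserstein1 f (empirical N \<xi>) \<le> ennreal \<epsilon>"
    using assms(1) by (auto simp: wasserstein_ball_def)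
  interpret f: prob_space f by fact
  have "ennreal (l * measure f {t<..}) - ennreal c \<le> wasserstein1 f (empirical N \<xi>)"
    unfolding wasserstein1_def
  proof (rule INF_greatest)
    fix \<pi> assume "\<pi> \<in> couplings f (empirical N \<xi>)"
    then have s: "sets \<pi> = sets borel" and f1: "distr \<pi> borel fst = f"
      and f2: "distr \<pi> borel snd = empirical N \<xi>" by (auto simp: couplings_def)
    have s' [measurable_cong]: "sets \<pi> = sets (borel \<Otimes>\<^sub>M borel)"
      unfolding s borel_prod ..
    have "ennreal (l * measure f {t<..}) = ennreal l * (\<integral>\<^sup>+ y. indicator {t<..} y \<partial>f)"
      using assms(4) by (simp add: ennreal_mult f.emeasure_eq_measure)
    also have "(\<integral>\<^sup>+ y. indicator {t<..} y \<partial>f) = (\<integral>\<^sup>+ z. indicator {t<..} (fst z) \<partial>\<pi>)"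
      unfolding f1[symmetric] by (rule nn_integral_distr) simp_all
    also have "ennreal l * \<dots> = (\<integral>\<^sup>+ z. ennreal l * indicator {t<..} (fst z) \<partial>\<pi>)"
      by (rule nn_integral_cmult[symmetric]) measurable
    also have "\<dots> \<le> (\<integral>\<^sup>+ z. ennreal \<bar>fst z - snd z\<bar>
        + ennreal (max 0 (l - max 0 (t - snd z))) \<partial>\<pi>)"
    proof (rule nn_integral_mono)
      fix z :: "real \<times> real"
      show "ennreal l * indicator {t<..} (fst z)
          \<le> ennreal \<bar>fst z - snd z\<bar> + ennreal (max 0 (l - max 0 (t - snd z)))"
      proof (cases "t < fst z")
        case True
        then have "l \<le> \<bar>fst z - snd z\<bar> + max 0 (l - max 0 (t - snd z))" by auto
        then have "ennreal l \<le> ennreal (\<bar>fst z - snd z\<bar> + max 0 (l - max 0 (t - snd z)))"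
          by (rule ennreal_leI)
        also have "\<dots> = ennreal \<bar>fst z - snd z\<bar> + ennreal (max 0 (l - max 0 (t - snd z)))"
          by (rule ennreal_plus) auto
        finally show ?thesis using True by simp
      qed simp
    qed
    also have "\<dots> = (\<integral>\<^sup>+ z. ennreal \<bar>fst z - snd z\<bar> \<partial>\<pi>)
        + (\<integral>\<^sup>+ z. ennreal (max 0 (l - max 0 (t - snd z))) \<partial>\<pi>)"
      by (rule nn_integral_add) measurable
    also have "(\<integral>\<^sup>+ z. ennreal (max 0 (l - max 0 (t - snd z))) \<partial>\<pi>)
        = (\<integral>\<^sup>+ s. ennreal (max 0 (l - max 0 (t - s))) \<partial>empirical N \<xi>)"
      unfolding f2[symmetric] by (simp add: nn_integral_distr)
    also have "\<dots> = ennreal c"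
      unfolding c_def using assms(2) by (intro nn_integral_empirical) auto
    finally show "ennreal (l * measure f {t<..}) - ennreal c
        \<le> (\<integral>\<^sup>+ z. ennreal \<bar>fst z - snd z\<bar> \<partial>\<pi>)"
      by (simp add: ennreal_minus_le_iff add.commute)
  qed
  also note W
  finally have "ennreal (l * measure f {t<..} - c) \<le> ennreal \<epsilon>"
    using c0 by (simp add: ennreal_minus)
  then show ?thesis using assms(3) unfolding c_def[symmetric] by (simp add: ennreal_le_iff)
qed

text \<open>
  An explicit distribution with a heavy tail: a fraction \<open>p n\<close> of the atom at \<open>\<xi> n\<close> is moved just
  beyond \<open>t\<close>. An independent uniform variable \<open>u\<close> decides which part of the atom moves
  (the part with \<open>u < p n\<close>) and at the same time spreads the mass over an interval of length at most
  \<open>\<delta>\<close>. The extra cost per unit of mass is at most \<open>2 * \<delta>\<close>: one \<open>\<delta>\<close> for landing strictly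
  beyond \<open>t\<close> and one for the spreading.
\<close>

lemma wasserstein_ball_transport:
  assumes "1 \<le> N" "\<And>n. 0 \<le> p n" "\<And>n. p n \<le> 1" "0 < \<delta>"
    and cost: "(\<Sum>n=1..N. p n * max 0 (t - \<xi> n)) / N + 2 * \<delta> \<le> \<epsilon>"
  shows "\<exists>f \<in> wasserstein_ball \<epsilon> (empirical N \<xi>).
           atomless f \<and> (\<Sum>n=1..N. p n) / N \<le> measure f {t<..}"
proof -
  define P where "P = measure_pmf (pmf_of_set {1..N})"
  define U where "U = uniform_measure lborel {0..1::real}"
  define \<phi> where "\<phi> = (\<lambda>(n, u). if u < p n then max (\<xi> n) t + \<delta> * (1 + u) else \<xi> n + \<delta> * u)"
  have [measurable_cong]: "sets P = sets (count_space UNIV)" "sets U = sets borel"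
    by (simp_all add: P_def U_def)
  interpret P: prob_space P unfolding P_def by (rule measure_pmf.prob_space_axioms)
  interpret U: prob_space U unfolding U_def by (rule prob_space_uniform_measure) auto
  interpret PU: pair_prob_space P U ..
  have meas_nat: "h \<in> borel_measurable (P \<Otimes>\<^sub>M U)"
    if "\<And>n. (\<lambda>u. h (n, u)) \<in> borel_measurable borel" for h :: "nat \<times> real \<Rightarrow> real"
  proof -
    have "h \<in> borel_measurable (count_space UNIV \<Otimes>\<^sub>M borel)"
      using that by (intro measurable_pair_measure_countable1) auto
    also have "borel_measurable (count_space UNIV \<Otimes>\<^sub>M borel) = borel_measurable (P \<Otimes>\<^sub>M U)"
      by (intro measurable_cong_sets sets_pair_measure_cong) (simp_all add: P_def U_def)
    finally show ?thesis .
  qed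
  have [measurable]: "(\<lambda>u. \<phi> (n, u)) \<in> borel_measurable borel" for n
    by (simp add: \<phi>_def)
  then have [measurable]: "\<phi> \<in> borel_measurable (P \<Otimes>\<^sub>M U)"
    by (rule meas_nat)
  have [measurable]: "(\<lambda>z. \<xi> (fst z)) \<in> borel_measurable (P \<Otimes>\<^sub>M U)"
    by (rule meas_nat) simp
  have average: "(\<integral>\<^sup>+ z. h z \<partial>(P \<Otimes>\<^sub>M U)) = (\<Sum>n=1..N. \<integral>\<^sup>+ u. h (n, u) \<partial>U) / N"
    if "h \<in> borel_measurable (P \<Otimes>\<^sub>M U)" for h
    unfolding U.nn_integral_fst[OF that, symmetric] unfolding P_def using assms(1)
    by (subst nn_integral_pmf_of_set) auto
  have U01: "emeasure U A = emeasure lborel ({0..1} \<inter> A)" if "A \<in> sets borel" for A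
    unfolding U_def using that by (simp add: divide_ennreal_def)
  have Ulow: "emeasure U {..<p n} = ennreal (p n)" for n
  proof -
    have "{0..1} \<inter> {..<p n} = {0..<p n}" using assms(3)[of n] by auto
    then show ?thesis using assms(2)[of n] by (simp add: U01)
  qed
  have AEU: "AE u in U. u \<in> {0..1}"
    unfolding U_def by (rule AE_uniform_measureI) auto

  \<comment> \<open>The moved mass and the sample it comes from live on the same space; their joint law is the
      coupling that bounds the distance.\<close>
  define f where "f = distr (P \<Otimes>\<^sub>M U) borel \<phi>"
  define \<pi> where "\<pi> = distr (P \<Otimes>\<^sub>M U) borel (\<lambda>z. (\<phi> z, \<xi> (fst z)))"
  have pairm [measurable]: "(\<lambda>z. (\<phi> z, \<xi> (fst z))) \<in> borel_measurable (P \<Otimes>\<^sub>M U)"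
    by (simp add: borel_prod[symmetric])
  have fstm: "(fst :: real \<times> real \<Rightarrow> real) \<in> borel_measurable borel"
    and sndm: "(snd :: real \<times> real \<Rightarrow> real) \<in> borel_measurable borel"
    by (simp_all add: borel_prod[symmetric])
  interpret f: prob_space f unfolding f_def by (rule PU.prob_space_distr) simp
  have sf: "sets f = sets borel" by (simp add: f_def)
  have "\<pi> \<in> couplings f (empirical N \<xi>)"
  proof -
    have "distr \<pi> borel snd = distr (distr (P \<Otimes>\<^sub>M U) P fst) borel \<xi>"
      unfolding \<pi>_def by (subst (1 2) distr_distr) (auto simp: comp_def sndm)
    also have "distr (P \<Otimes>\<^sub>M U) P fst = P"
      by (rule U.distr_pair_fst)
    finally have "distr \<pi> borel snd = empirical N \<xi>"
      by (simp add: empirical_def P_def)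
    moreover have "distr \<pi> borel fst = f"
      unfolding \<pi>_def f_def by (subst distr_distr) (auto simp: comp_def fstm)
    ultimately show ?thesis by (auto simp: couplings_def \<pi>_def)
  qed
  then have "wasserstein1 f (empirical N \<xi>) \<le> (\<integral>\<^sup>+ z. ennreal \<bar>fst z - snd z\<bar> \<partial>\<pi>)"
    unfolding wasserstein1_def by (rule INF_lower)
  also have "\<dots> = (\<integral>\<^sup>+ z. ennreal \<bar>\<phi> z - \<xi> (fst z)\<bar> \<partial>(P \<Otimes>\<^sub>M U))"
    unfolding \<pi>_def using fstm sndm by (subst nn_integral_distr) auto
  also have "\<dots> = (\<Sum>n=1..N. \<integral>\<^sup>+ u. ennreal \<bar>\<phi> (n, u) - \<xi> n\<bar> \<partial>U) / N"
    by (subst average) auto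
  also have "\<dots> \<le> (\<Sum>n=1..N. ennreal (p n * max 0 (t - \<xi> n) + 2 * \<delta>)) / N"
  proof (intro divide_right_mono_ennreal sum_mono)
    fix n
    have "(\<integral>\<^sup>+ u. ennreal \<bar>\<phi> (n, u) - \<xi> n\<bar> \<partial>U)
        \<le> (\<integral>\<^sup>+ u. ennreal (max 0 (t - \<xi> n)) * indicator {..<p n} u + ennreal (2 * \<delta>) \<partial>U)"
    proof (rule nn_integral_mono_AE, use AEU in eventually_elim)
      fix u :: real assume u: "u \<in> {0..1}"
      have d: "0 \<le> \<delta> * u" "\<delta> * u \<le> \<delta>" using u assms(4) by (auto simp: mult_left_le)
      show "ennreal \<bar>\<phi> (n, u) - \<xi> n\<bar>
          \<le> ennreal (max 0 (t - \<xi> n)) * indicator {..<p n} u + ennreal (2 * \<delta>)"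
      proof (cases "u < p n")
        case True
        then have "\<phi> (n, u) - \<xi> n = max 0 (t - \<xi> n) + (\<delta> + \<delta> * u)"
          by (auto simp: \<phi>_def algebra_simps max_def)
        then have "\<bar>\<phi> (n, u) - \<xi> n\<bar> \<le> max 0 (t - \<xi> n) + 2 * \<delta>"
          using d assms(4) by linarith
        then have "ennreal \<bar>\<phi> (n, u) - \<xi> n\<bar> \<le> ennreal (max 0 (t - \<xi> n) + 2 * \<delta>)"
          by (rule ennreal_leI)
        also have "\<dots> = ennreal (max 0 (t - \<xi> n)) + ennreal (2 * \<delta>)"
          using assms(4) by (intro ennreal_plus) auto
        finally show ?thesis using True by simp
      next
        case False
        then show ?thesis using d assms(4) by (auto simp: \<phi>_def intro!: ennreal_leI)
      qed
    qed
    also have "\<dots> = ennreal (max 0 (t - \<xi> n)) * ennreal (p n) + ennreal (2 * \<delta>)"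
      by (simp add: nn_integral_add nn_integral_cmult Ulow U.emeasure_space_1)
    also have "\<dots> = ennreal (p n * max 0 (t - \<xi> n) + 2 * \<delta>)"
      using assms(2)[of n] assms(4)
      by (subst ennreal_plus) (auto simp: ennreal_mult mult.commute simp del: max.absorb2)
    finally show "(\<integral>\<^sup>+ u. ennreal \<bar>\<phi> (n, u) - \<xi> n\<bar> \<partial>U)
        \<le> ennreal (p n * max 0 (t - \<xi> n) + 2 * \<delta>)" .
  qed
  also have "\<dots> = ennreal ((\<Sum>n=1..N. p n * max 0 (t - \<xi> n) + 2 * \<delta>) / N)"
    using assms by (subst sum_ennreal)
      (auto simp: ennreal_of_nat_eq_real_of_nat divide_ennreal sum_nonneg)
  also have "(\<Sum>n=1..N. p n * max 0 (t - \<xi> n) + 2 * \<delta>) / N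
      = (\<Sum>n=1..N. p n * max 0 (t - \<xi> n)) / N + 2 * \<delta>"
    using assms(1) by (simp add: sum.distrib add_divide_distrib)
  also have "ennreal \<dots> \<le> ennreal \<epsilon>" using cost by (rule ennreal_leI)
  finally have ball: "f \<in> wasserstein_ball \<epsilon> (empirical N \<xi>)"
    by (simp add: wasserstein_ball_def sf f.prob_space_axioms)

  \<comment> \<open>Conditioning on the atom reduces the two remaining claims to one-dimensional ones about
      \<open>u\<close>.\<close>
  have emf: "emeasure f A = (\<Sum>n=1..N. emeasure U {u. \<phi> (n, u) \<in> A}) / N"
    if [measurable]: "A \<in> sets borel" for A
  proof -
    have "emeasure f A = (\<integral>\<^sup>+ y. indicator A y \<partial>f)" by (simp add: sf)
    also have "\<dots> = (\<integral>\<^sup>+ z. indicator A (\<phi> z) \<partial>(P \<Otimes>\<^sub>M U))"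
      unfolding f_def by (subst nn_integral_distr) auto
    also have "\<dots> = (\<Sum>n=1..N. \<integral>\<^sup>+ u. indicator A (\<phi> (n, u)) \<partial>U) / N"
      by (rule average) measurable
    also have "\<dots> = (\<Sum>n=1..N. emeasure U {u. \<phi> (n, u) \<in> A}) / N"
    proof -
      have "(\<integral>\<^sup>+ u. indicator A (\<phi> (n, u)) \<partial>U) = emeasure U {u. \<phi> (n, u) \<in> A}" for n
      proof -
        have "(\<lambda>u. indicator A (\<phi> (n, u)) :: ennreal) = indicator {u. \<phi> (n, u) \<in> A}"
          by (auto simp: indicator_def)
        moreover have "{u. \<phi> (n, u) \<in> A} \<in> sets U" by measurable
        ultimately show ?thesis by simp
      qed
      then show ?thesis by simp
    qed
    finally show ?thesis .
  qed
  have "atomless f"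
    unfolding atomless_def
  proof
    fix a
    have "emeasure U {u. \<phi> (n, u) \<in> {a}} = 0" for n
    proof -
      have fin: "finite {u. \<phi> (n, u) \<in> {a}}"
      proof (rule finite_subset)
        \<comment> \<open>Each of the two branches of \<open>\<phi> (n, \<cdot>)\<close> is affine with slope \<open>\<delta> \<noteq> 0\<close>.\<close>
        show "{u. \<phi> (n, u) \<in> {a}} \<subseteq> {(a - max (\<xi> n) t) / \<delta> - 1, (a - \<xi> n) / \<delta>}"
        proof
          fix u assume "u \<in> {u. \<phi> (n, u) \<in> {a}}"
          then have a: "a = \<phi> (n, u)" by simp
          show "u \<in> {(a - max (\<xi> n) t) / \<delta> - 1, (a - \<xi> n) / \<delta>}"
            unfolding a using assms(4) by (cases "u < p n") (simp_all add: \<phi>_def)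
        qed
      qed simp
      then show ?thesis
        by (subst U01) (auto simp: finite_imp_null_set_lborel null_setsD1 borel_closed finite_imp_closed)
    qed
    then have "emeasure f {a} = 0" by (simp only: emf borel_singleton sets.empty_sets) simp
    then show "measure f {a} = 0" by (simp add: measure_def)
  qed
  moreover have "(\<Sum>n=1..N. p n) / N \<le> measure f {t<..}"
  proof -
    have "ennreal ((\<Sum>n=1..N. p n) / N) = (\<Sum>n=1..N. emeasure U {..<p n}) / N"
      using assms(1,2) by (simp add: Ulow sum_ennreal ennreal_of_nat_eq_real_of_nat
          divide_ennreal sum_nonneg)
    also have "\<dots> \<le> emeasure f {t<..}"
    proof (subst emf, simp, intro divide_right_mono_ennreal sum_mono emeasure_mono_AE)
      fix n
      show "AE u in U. u \<in> {..<p n} \<longrightarrow> u \<in> {u. \<phi> (n, u) \<in> {t<..}}"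
        using AEU
      proof eventually_elim
        fix u :: real assume "u \<in> {0..1}"
        then have "0 < \<delta> * (1 + u)" using assms(4) by auto
        then show "u \<in> {..<p n} \<longrightarrow> u \<in> {u. \<phi> (n, u) \<in> {t<..}}"
          by (auto simp: \<phi>_def)
      qed
      show "{u. \<phi> (n, u) \<in> {t<..}} \<in> sets U"
        by measurable
    qed
    finally show ?thesis by (simp add: f.emeasure_eq_measure)
  qed
  ultimately show ?thesis using ball by blast
qed

text \<open>
  Both inclusions for \<open>D\<close> are needed because the two halves of the proof use different members of
  it: the bound holds for all distributions of the ball, and the counterexample can be taken
  atomless.
\<close>

lemma chance_constraint_iff_partial_sum:
  assumes "1 \<le> N" and dec: "antimono_on {1..N} \<xi>"
    and "0 < \<epsilon>" "0 \<le> \<alpha>" "\<alpha> < 1"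
    and lower: "{f \<in> wasserstein_ball \<epsilon> (empirical N \<xi>). atomless f} \<subseteq> D"
    and upper: "D \<subseteq> wasserstein_ball \<epsilon> (empirical N \<xi>)"
  shows "1 - \<alpha> \<le> (INF f\<in>D. measure f {y. t \<ge> y}) \<longleftrightarrow>
         real N * \<epsilon> \<le> partial_sum (\<lambda>n. max 0 (t - \<xi> n)) (\<alpha> * real N)"
proof -
  define a where "a = (\<lambda>n. max 0 (t - \<xi> n))"
  define r where "r = \<alpha> * real N"
  define k where "k = nat \<lfloor>r\<rfloor>"
  have r: "0 \<le> r" "r < real N" using assms by (auto simp: r_def)
  have k: "real k \<le> r" "r < real k + 1" "k < N" using r unfolding k_def by linarith+
  note S = partial_sum_eq[OF k(1) less_imp_le[OF k(2)], of a]
  have compl: "measure f {y. t \<ge> y} = 1 - measure f {t<..}" if "f \<in> D" for f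
  proof -
    interpret prob_space f using that upper by (auto simp: wasserstein_ball_def)
    have sf: "sets f = sets borel" using that upper by (auto simp: wasserstein_ball_def)
    then have "space f = UNIV" by (metis sets_eq_imp_space_eq space_borel)
    then have "space f - {t<..} = {y. t \<ge> y}" by auto
    with prob_compl[of "{t<..}"] sf show ?thesis by simp
  qed
  have "mono_on {1..N} a"
  proof (rule mono_onI)
    fix m n assume "m \<in> {1..N}" "n \<in> {1..N}" "m \<le> n"
    then have "\<xi> n \<le> \<xi> m" by (rule monotone_onD[OF dec])
    then show "a m \<le> a n" by (auto simp: a_def)
  qed
  note dual = partial_sum_dual[OF this r, folded k_def]
  have le: "1 - \<alpha> \<le> measure f {y. t \<ge> y}" if S': "real N * \<epsilon> \<le> partial_sum a r" and "f \<in> D" for f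
  proof (rule ccontr)
    assume "\<not> ?thesis"
    then have b: "\<alpha> < measure f {t<..}" using compl[OF \<open>f \<in> D\<close>] by simp
    \<comment> \<open>With price \<open>l = 0\<close> the dual expression, hence the cost of the fraction \<open>\<alpha>\<close>, could not
        be positive.\<close>
    define l where "l = a (k + 1)"
    have l0: "0 < l"
    proof (rule ccontr)
      assume "\<not> 0 < l"
      then have "l = 0" by (simp add: l_def a_def)
      with dual have "partial_sum a r \<le> 0" by (auto simp: l_def intro!: sum_nonneg)
      with S' \<open>0 < \<epsilon>\<close> \<open>1 \<le> N\<close> show False by (smt (verit) mult_pos_pos of_nat_1 of_nat_mono)
    qed
    have "l * measure f {t<..} - (\<Sum>n=1..N. max 0 (l - a n)) / N \<le> \<epsilon>"
      unfolding a_def using that(2) upper assms l0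
      by (intro wasserstein_ball_tail_bound) auto
    then have "N * (l * measure f {t<..}) - (\<Sum>n=1..N. max 0 (l - a n)) \<le> N * \<epsilon>"
      using \<open>1 \<le> N\<close> by (simp add: field_simps)
    moreover have "partial_sum a r = N * (l * \<alpha>) - (\<Sum>n=1..N. max 0 (l - a n))"
      using dual by (simp add: l_def r_def algebra_simps)
    moreover have "N * (l * \<alpha>) < N * (l * measure f {t<..})"
      using b l0 \<open>1 \<le> N\<close> by simp
    ultimately show False using S' by linarith
  qed
  \<comment> \<open>Moving nothing and only smearing the atoms shows that \<open>D\<close> is nonempty; over the empty set
      the infimum of reals would carry no information.\<close>
  have "\<exists>f \<in> wasserstein_ball \<epsilon> (empirical N \<xi>).
           atomless f \<and> (\<Sum>n=1..N. 0) / N \<le> measure f {t<..}"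
    using assms(1,3) by (intro wasserstein_ball_transport[where \<delta> = "\<epsilon> / 2"]) auto
  then have ne: "D \<noteq> {}" using lower by auto
  have gt: "\<exists>f\<in>D. measure f {y. t \<ge> y} < 1 - \<alpha>" if S': "partial_sum a r < real N * \<epsilon>"
  proof -
    define \<eta> where "\<eta> = real N * \<epsilon> - partial_sum a r"
    have "0 < \<eta>" using S' by (simp add: \<eta>_def)
    have a0: "0 \<le> a (k + 1)" by (simp add: a_def)
    \<comment> \<open>Half of the slack \<open>\<eta>\<close> pays for raising the moved amount from \<open>r\<close> to \<open>r + h\<close>, the other
        half for the spreading. The \<open>+ 1\<close> keeps the denominator positive when the distance
        \<open>a (k + 1)\<close> is zero, and the minimum keeps the last fraction at most \<open>1\<close>.\<close>
    define h where "h = min (real k + 1 - r) (\<eta> / (2 * (a (k + 1) + 1)))"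
    have h: "0 < h" "h \<le> real k + 1 - r" using k a0 \<open>0 < \<eta>\<close> by (auto simp: h_def)
    have "h * a (k + 1) \<le> \<eta> / (2 * (a (k + 1) + 1)) * a (k + 1)"
      using a0 by (intro mult_right_mono) (auto simp: h_def)
    also have "\<dots> \<le> \<eta> / 2" using a0 \<open>0 < \<eta>\<close> by (simp add: field_simps)
    finally have ha: "h * a (k + 1) \<le> \<eta> / 2" .
    define p where "p n = (if n \<le> k then 1 else if n = k + 1 then r + h - real k else 0)" for n
    have split: "(\<Sum>n=1..N. p n * b n) = (\<Sum>n=1..k. b n) + (r + h - real k) * b (k + 1)" for b
    proof -
      have "(\<Sum>n=1..N. p n * b n) = (\<Sum>n=1..Suc k. p n * b n)"
        using k by (intro sum.mono_neutral_right) (auto simp: p_def)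
      also have "\<dots> = (\<Sum>n=1..k. b n) + (r + h - real k) * b (k + 1)"
        by (simp add: p_def)
      finally show ?thesis .
    qed
    have "(\<Sum>n=1..N. p n * a n) \<le> real N * \<epsilon> - \<eta> / 2"
    proof -
      have "(r + h - real k) * a (k + 1) = (r - real k) * a (k + 1) + h * a (k + 1)"
        by (simp add: algebra_simps)
      then show ?thesis unfolding split using S ha \<eta>_def by linarith
    qed
    then have "(\<Sum>n=1..N. p n * a n) / N + 2 * (\<eta> / (4 * N)) \<le> \<epsilon>"
      using \<open>1 \<le> N\<close> by (simp add: field_simps)
    then have "\<exists>f \<in> wasserstein_ball \<epsilon> (empirical N \<xi>).
           atomless f \<and> (\<Sum>n=1..N. p n) / N \<le> measure f {t<..}"
      unfolding a_def using assms(1) \<open>0 < \<eta>\<close> h k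
      by (intro wasserstein_ball_transport[where \<delta> = "\<eta> / (4 * N)"]) (auto simp: p_def)
    then obtain f where f: "f \<in> D" "(\<Sum>n=1..N. p n) / N \<le> measure f {t<..}"
      using lower by blast
    have "(\<Sum>n=1..N. p n) = r + h" using split[of "\<lambda>_. 1"] by simp
    then have "\<alpha> < (\<Sum>n=1..N. p n) / N"
      using h \<open>1 \<le> N\<close> by (simp add: r_def field_simps)
    with f compl[OF f(1)] show ?thesis by (intro bexI[of _ f]) auto
  qed
  have bdd: "bdd_below ((\<lambda>f. measure f {y. t \<ge> y}) ` D)"
    by (rule bdd_belowI2[where m = 0]) simp
  have "1 - \<alpha> \<le> (INF f\<in>D. measure f {y. t \<ge> y}) \<longleftrightarrow> (\<forall>f\<in>D. 1 - \<alpha> \<le> measure f {y. t \<ge> y})"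
    by (rule le_cINF_iff[OF ne bdd])
  also have "\<dots> \<longleftrightarrow> real N * \<epsilon> \<le> partial_sum a r"
    using le gt by (meson not_le)
  finally show ?thesis by (simp add: a_def r_def)
qed

section \<open>Binary arrays that select one cell\<close>

lemma sum_triangle_single:
  fixes F :: "nat \<Rightarrow> nat \<Rightarrow> real"
  assumes "j \<le> k" "k < N"
    and "\<forall>b<N. \<forall>a\<le>b. ob a b = (if a = j \<and> b = k then 1 else 0)"
  shows "(\<Sum>a<N. \<Sum>b=a..<N. ob a b * F a b) = F j k"
    and "(\<Sum>a<N. \<Sum>b=a..<N. F a b * ob a b) = F j k"
    and "(\<Sum>a<N. \<Sum>b=a..<N. ob a b) = 1"
proof -
  have *: "(\<Sum>a<N. \<Sum>b=a..<N. ob a b * G a b) = G j k" for G :: "nat \<Rightarrow> nat \<Rightarrow> real"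
  proof -
    have "(\<Sum>a<N. \<Sum>b=a..<N. ob a b * G a b)
        = (\<Sum>z\<in>(SIGMA a:{..<N}. {a..<N}). ob (fst z) (snd z) * G (fst z) (snd z))"
      by (subst sum.Sigma) (auto simp: case_prod_beta)
    also have "\<dots> = (\<Sum>z\<in>{(j, k)}. ob (fst z) (snd z) * G (fst z) (snd z))"
    proof (intro sum.mono_neutral_right ballI)
      fix z assume "z \<in> (SIGMA a:{..<N}. {a..<N}) - {(j, k)}"
      then have "ob (fst z) (snd z) = 0" using assms(3) by (cases z) simp
      then show "ob (fst z) (snd z) * G (fst z) (snd z) = 0" by simp
    qed (use assms(1,2) in auto)
    finally show ?thesis using assms by simp
  qed
  show "(\<Sum>a<N. \<Sum>b=a..<N. ob a b * F a b) = F j k" by (rule *)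
  then show "(\<Sum>a<N. \<Sum>b=a..<N. F a b * ob a b) = F j k" by (simp add: mult.commute)
  show "(\<Sum>a<N. \<Sum>b=a..<N. ob a b) = 1" using *[of "\<lambda>_ _. 1"] by simp
qed

text \<open>A sum of zeros and ones counts the ones.\<close>

lemma triangle_one_hot:
  fixes ob :: "nat \<Rightarrow> nat \<Rightarrow> real"
  assumes bin: "\<forall>j<N. \<forall>k\<in>{j..<N}. ob j k \<in> {0, 1}"
    and one: "(\<Sum>j<N. \<Sum>k=j..<N. ob j k) = 1"
  obtains j k where "j \<le> k" "k < N"
    "\<forall>b<N. \<forall>a\<le>b. ob a b = (if a = j \<and> b = k then 1 else 0)"
proof -
  define I where "I = (SIGMA a:{..<N}. {a..<N})"
  define q where "q z = ob (fst z) (snd z)" for z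
  have fin: "finite I" by (simp add: I_def)
  have q: "q z \<in> {0, 1}" if "z \<in> I" for z
    using that bin unfolding I_def q_def by (cases z) simp
  have sum1: "sum q I = 1"
    using one by (subst (asm) sum.Sigma) (auto simp: I_def q_def case_prod_beta)
  have "real (card {z \<in> I. q z = 1}) = (\<Sum>z\<in>I. if q z = 1 then 1 else 0)"
    using fin by (simp add: sum.If_cases Int_def)
  also have "\<dots> = sum q I" using q by (intro sum.cong) auto
  finally have "card {z \<in> I. q z = 1} = 1" using sum1 by simp
  then obtain z where z: "{z \<in> I. q z = 1} = {z}" by (auto simp: card_1_singleton_iff)
  show thesis
  proof
    have "z \<in> I" using z by blast
    then show "fst z \<le> snd z" "snd z < N" by (auto simp: I_def)
    show "\<forall>b<N. \<forall>a\<le>b. ob a b = (if a = fst z \<and> b = snd z then 1 else 0)"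
    proof (intro allI impI)
      fix a b assume "b < N" "a \<le> b"
      then have ab: "(a, b) \<in> I" by (simp add: I_def)
      have "q (a, b) = 1 \<longleftrightarrow> (a, b) = z" using z ab by blast
      with q[OF ab] show "ob a b = (if a = fst z \<and> b = snd z then 1 else 0)"
        by (auto simp: q_def)
    qed
  qed
qed

section \<open>The cells of the mixed-integer formulation\<close>

text \<open>
  For a selected cell \<open>u\<close> and \<open>w\<close> occur only in \<open>0 \<le> u \<le> \<alpha> N - j\<close>,
  \<open>0 \<le> w \<le> T \<bullet> x - \<xi> (k+1)\<close> and a lower bound on \<open>u * w\<close>. The cell constraints make both upper
  bounds nonnegative, so choosing \<open>u\<close> and \<open>w\<close> at these bounds loses nothing.
\<close>

lemma micp_feasible_iff_cell:
  assumes dec: "antimono_on {..N} \<xi>"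
  shows "(\<exists>ob u w. micp_feasible X T \<alpha>max N \<xi> \<epsilon> x ob \<alpha> u w) \<longleftrightarrow>
    x \<in> X \<and> \<alpha> \<in> {0<..\<alpha>max} \<and>
    (\<exists>j k. j \<le> k \<and> k < N \<and> \<xi> (j+1) \<le> T \<bullet> x \<and> T \<bullet> x \<le> \<xi> j \<and>
           real k \<le> \<alpha> * N \<and> \<alpha> * N \<le> real k + 1 \<and>
           (\<Sum>i=j+1..k. \<xi> i - \<xi> (k+1)) + N * \<epsilon> \<le> (\<alpha> * N - j) * (T \<bullet> x - \<xi> (k+1)))"
    (is "?L \<longleftrightarrow> ?R")
proof
  assume ?L
  then obtain ob u w where F: "micp_feasible X T \<alpha>max N \<xi> \<epsilon> x ob \<alpha> u w" by blast
  then have "\<forall>j<N. \<forall>k\<in>{j..<N}. ob j k \<in> {0, 1}"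
    unfolding micp_feasible_def by (elim conjE)
  moreover from F have "(\<Sum>j<N. \<Sum>k=j..<N. ob j k) = 1"
    unfolding micp_feasible_def by (elim conjE)
  ultimately
  obtain j k where jk: "j \<le> k" "k < N"
    and ob: "\<forall>b<N. \<forall>a\<le>b. ob a b = (if a = j \<and> b = k then 1 else 0)"
    by (rule triangle_one_hot) blast
  note F' = F[unfolded micp_feasible_def sum_triangle_single[OF jk ob]]
  have "u * w \<le> (\<alpha> * N - j) * (T \<bullet> x - \<xi> (k+1))"
    using F' by (intro mult_mono) auto
  with F' jk show ?R by (intro conjI exI[of _ j] exI[of _ k]) auto
next
  assume ?R
  then obtain j k where jk: "j \<le> k" "k < N"
    and R: "\<xi> (j+1) \<le> T \<bullet> x" "T \<bullet> x \<le> \<xi> j" "real k \<le> \<alpha> * N" "\<alpha> * N \<le> real k + 1"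
      "(\<Sum>i=j+1..k. \<xi> i - \<xi> (k+1)) + N * \<epsilon> \<le> (\<alpha> * N - j) * (T \<bullet> x - \<xi> (k+1))"
    and x: "x \<in> X" "\<alpha> \<in> {0<..\<alpha>max}" by blast
  define ob :: "nat \<Rightarrow> nat \<Rightarrow> real" where "ob a b = (if a = j \<and> b = k then 1 else 0)" for a b
  have ob: "\<forall>b<N. \<forall>a\<le>b. ob a b = (if a = j \<and> b = k then 1 else 0)"
    by (simp add: ob_def)
  have "\<xi> (k+1) \<le> \<xi> (j+1)" using jk by (intro monotone_onD[OF dec]) auto
  then have "micp_feasible X T \<alpha>max N \<xi> \<epsilon> x ob \<alpha> (\<alpha> * N - j) (T \<bullet> x - \<xi> (k+1))"
    unfolding micp_feasible_def sum_triangle_single[OF jk ob]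
    using R x jk by (auto simp: ob_def)
  then show ?L by blast
qed

text \<open>
  In the cell the terms with \<open>n \<le> j\<close> vanish and the later ones are \<open>t - \<xi> n\<close> without
  truncation; writing \<open>t - \<xi> n = (t - \<xi> (k+1)) - (\<xi> n - \<xi> (k+1))\<close> collects the dependence on
  \<open>t\<close> and \<open>r\<close> in one product.
\<close>

lemma partial_sum_cell:
  assumes dec: "antimono_on {..N} \<xi>"
    and "j \<le> k" "k < N" "\<xi> (j+1) \<le> t" "t \<le> \<xi> j" "real k \<le> r" "r \<le> real k + 1"
  shows "partial_sum (\<lambda>n. max 0 (t - \<xi> n)) r
       = (r - j) * (t - \<xi> (k+1)) - (\<Sum>i=j+1..k. \<xi> i - \<xi> (k+1))"
proof -
  have gt: "max 0 (t - \<xi> n) = t - \<xi> n" if "j < n" "n \<le> N" for n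
    using monotone_onD[OF dec, of "j+1" n] that assms(4) by auto
  have le: "max 0 (t - \<xi> n) = 0" if "n \<le> j" for n
    using monotone_onD[OF dec, of n j] that assms(2,3,5) by auto
  have "(\<Sum>n=1..k. max 0 (t - \<xi> n)) = (\<Sum>n=j+1..k. t - \<xi> n)"
    using assms(2,3) by (intro sum.mono_neutral_cong_right) (auto simp: gt le)
  also have "\<dots> = (\<Sum>n=j+1..k. (t - \<xi> (k+1)) - (\<xi> n - \<xi> (k+1)))" by simp
  also have "\<dots> = (real k - j) * (t - \<xi> (k+1)) - (\<Sum>i=j+1..k. \<xi> i - \<xi> (k+1))"
    unfolding sum_subtractf[of "\<lambda>_. t - \<xi> (k+1)"] using assms(2) by (simp add: of_nat_diff)
  finally show ?thesis
    unfolding partial_sum_eq[OF assms(6,7)] using gt[of "k+1"] assms(2,3)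
    by (simp add: algebra_simps)
qed

text \<open>
  Positivity supplies an index \<open>j \<le> k\<close>: if \<open>t\<close> lay below \<open>\<xi> (k+1)\<close>, all the terms summed
  would be zero. When the least such \<open>j\<close> is \<open>0\<close>, the upper end of its interval is the bound \<open>\<xi> 0\<close>.
\<close>

lemma cell_exists:
  assumes dec: "antimono_on {..N} \<xi>"
    and "0 \<le> r" "r < real N" "t \<le> \<xi> 0"
    and pos: "0 < partial_sum (\<lambda>n. max 0 (t - \<xi> n)) r"
  obtains j k where "j \<le> k" "k < N" "\<xi> (j+1) \<le> t" "t \<le> \<xi> j" "real k \<le> r" "r \<le> real k + 1"
proof -
  define k where "k = nat \<lfloor>r\<rfloor>"
  have k: "real k \<le> r" "r \<le> real k + 1" "k < N"
    using assms(2,3) unfolding k_def by linarith+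
  have tk: "\<xi> (k+1) \<le> t"
  proof (rule ccontr)
    assume "\<not> ?thesis"
    then have "max 0 (t - \<xi> n) = 0" if "n \<le> k + 1" for n
      using monotone_onD[OF dec, of n "k+1"] that k by auto
    with pos show False by (simp add: partial_sum_eq[OF k(1,2)])
  qed
  define j where "j = (LEAST j. \<xi> (j+1) \<le> t)"
  have j: "j \<le> k" "\<xi> (j+1) \<le> t" unfolding j_def by (rule Least_le LeastI, fact tk)+
  have "t \<le> \<xi> j"
  proof (cases j)
    case (Suc i)
    then have "\<not> \<xi> (i+1) \<le> t" unfolding j_def by (metis lessI not_less_Least)
    with Suc show ?thesis by simp
  qed (use assms in simp)
  with j k show thesis by (intro that) auto
qed

section \<open>Equivalence of the two optimization problems\<close>

theorem theorem3:
  fixes X :: "(real ^ 'd) set" and T c :: "real ^ 'd"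
    and g :: "real \<Rightarrow> real" and \<alpha>max \<epsilon> :: real
    and N :: nat and \<xi> :: "nat \<Rightarrow> real" and D :: "real measure set"
  assumes "0 < \<alpha>max" "\<alpha>max < 1"
    and "mono_on {0..\<alpha>max} g" and "\<And>\<alpha>. \<alpha> \<in> {0..\<alpha>max} \<Longrightarrow> 0 \<le> g \<alpha>"
    and "1 \<le> N" and "\<And>m n. m \<le> n \<Longrightarrow> n \<le> N \<Longrightarrow> \<xi> n \<le> \<xi> m"
    and "0 < \<epsilon>"
    and "D = wasserstein_ball \<epsilon> (empirical N \<xi>) \<or>
         D = {f \<in> wasserstein_ball \<epsilon> (empirical N \<xi>). atomless f}"
    and "(\<exists>x \<alpha>. drcc_feasible X T \<alpha>max D x \<alpha>) \<Longrightarrow>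
         (\<exists>x \<alpha>. drcc_optimal X T c g \<alpha>max D x \<alpha> \<and> T \<bullet> x \<ge> \<xi> N \<and> T \<bullet> x \<le> \<xi> 0)"
  shows "(\<forall>x \<alpha>. (\<exists>ob u w. micp_feasible X T \<alpha>max N \<xi> \<epsilon> x ob \<alpha> u w) \<longleftrightarrow>
             drcc_feasible X T \<alpha>max D x \<alpha> \<and> T \<bullet> x \<le> \<xi> 0) \<and>
         (\<forall>x \<alpha>. (\<exists>ob u w. micp_optimal X T c g \<alpha>max N \<xi> \<epsilon> x ob \<alpha> u w) \<longleftrightarrow>
             drcc_optimal X T c g \<alpha>max D x \<alpha> \<and> T \<bullet> x \<le> \<xi> 0) \<and>
         micp_value X T c g \<alpha>max N \<xi> \<epsilon> = drcc_value X T c g \<alpha>max D"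
proof -
  have dec: "antimono_on {..N} \<xi>"
    by (rule monotone_onI) (use assms(6) in auto)
  have feas: "(\<exists>ob u w. micp_feasible X T \<alpha>max N \<xi> \<epsilon> x ob \<alpha> u w) \<longleftrightarrow>
      drcc_feasible X T \<alpha>max D x \<alpha> \<and> T \<bullet> x \<le> \<xi> 0" for x \<alpha>
  proof (cases "\<alpha> \<in> {0..\<alpha>max}")
    case True
    let ?S = "partial_sum (\<lambda>n. max 0 (T \<bullet> x - \<xi> n)) (\<alpha> * real N)"
    have \<alpha>: "0 \<le> \<alpha>" "\<alpha> < 1" using True assms(2) by auto
    have r: "0 \<le> \<alpha> * real N" "\<alpha> * real N < real N" using \<alpha> assms(5) by auto
    have "1 - \<alpha> \<le> (INF f\<in>D. measure f {y. T \<bullet> x \<ge> y}) \<longleftrightarrow> real N * \<epsilon> \<le> ?S"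
      using assms(8)
      by (intro chance_constraint_iff_partial_sum[OF assms(5) _ assms(7) \<alpha>]
            monotone_on_subset[OF dec]) auto
    then have "drcc_feasible X T \<alpha>max D x \<alpha> \<longleftrightarrow> x \<in> X \<and> real N * \<epsilon> \<le> ?S"
      unfolding drcc_feasible_def using True by blast
    moreover have "(\<exists>j k. j \<le> k \<and> k < N \<and> \<xi> (j+1) \<le> T \<bullet> x \<and> T \<bullet> x \<le> \<xi> j \<and>
           real k \<le> \<alpha> * N \<and> \<alpha> * N \<le> real k + 1 \<and>
           (\<Sum>i=j+1..k. \<xi> i - \<xi> (k+1)) + N * \<epsilon> \<le> (\<alpha> * N - j) * (T \<bullet> x - \<xi> (k+1)))
        \<longleftrightarrow> real N * \<epsilon> \<le> ?S \<and> T \<bullet> x \<le> \<xi> 0" (is "?cell \<longleftrightarrow> _")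
    proof
      assume ?cell
      then obtain j k where jk: "j \<le> k" "k < N" "\<xi> (j+1) \<le> T \<bullet> x" "T \<bullet> x \<le> \<xi> j"
           "real k \<le> \<alpha> * N" "\<alpha> * N \<le> real k + 1"
         and ineq: "(\<Sum>i=j+1..k. \<xi> i - \<xi> (k+1)) + N * \<epsilon> \<le> (\<alpha> * N - j) * (T \<bullet> x - \<xi> (k+1))"
        by blast
      from ineq partial_sum_cell[OF dec jk] have "real N * \<epsilon> \<le> ?S" by linarith
      moreover have "T \<bullet> x \<le> \<xi> 0" using jk monotone_onD[OF dec, of 0 j] by simp
      ultimately show "real N * \<epsilon> \<le> ?S \<and> T \<bullet> x \<le> \<xi> 0" by blast
    next
      assume S: "real N * \<epsilon> \<le> ?S \<and> T \<bullet> x \<le> \<xi> 0"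
      then have t0: "T \<bullet> x \<le> \<xi> 0" by blast
      have "0 < real N * \<epsilon>" using assms(5,7) by simp
      then have S0: "0 < ?S" using S by linarith
      obtain j k where jk: "j \<le> k" "k < N" "\<xi> (j+1) \<le> T \<bullet> x" "T \<bullet> x \<le> \<xi> j"
           "real k \<le> \<alpha> * N" "\<alpha> * N \<le> real k + 1"
        by (rule cell_exists[OF dec r t0 S0])
      from S partial_sum_cell[OF dec jk]
      have "(\<Sum>i=j+1..k. \<xi> i - \<xi> (k+1)) + N * \<epsilon> \<le> (\<alpha> * N - j) * (T \<bullet> x - \<xi> (k+1))"
        by linarith
      with jk show ?cell by blast
    qed
    \<comment> \<open>For \<open>\<alpha> = 0\<close> the partial sum is empty, so excluding this value costs no feasible
        point.\<close>
    moreover have "\<alpha> \<in> {0<..\<alpha>max}" if "real N * \<epsilon> \<le> ?S"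
    proof -
      have "0 < real N * \<epsilon>" using assms(5,7) by simp
      then have "\<alpha> \<noteq> 0" using that by (auto simp: partial_sum_def)
      with True show ?thesis by auto
    qed
    ultimately show ?thesis unfolding micp_feasible_iff_cell[OF dec] by blast
  next
    case False
    then show ?thesis by (auto simp: drcc_feasible_def micp_feasible_def)
  qed
  let ?D = "drcc_feasible X T \<alpha>max D"
  \<comment> \<open>A minimizer that obeys the bound \<open>\<xi> 0\<close> competes in both problems; every comparison with a
      point that violates the bound can be replaced by a comparison with it.\<close>
  have best: "\<exists>x' \<alpha>'. drcc_optimal X T c g \<alpha>max D x' \<alpha>' \<and> T \<bullet> x' \<le> \<xi> 0
      \<and> ?D x' \<alpha>' \<and> (\<forall>y \<beta>. ?D y \<beta> \<longrightarrow> risk_cost c g x' \<alpha>' \<le> risk_cost c g y \<beta>)"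
    if "\<exists>x \<alpha>. ?D x \<alpha>"
    using assms(9)[OF that] by (force simp: drcc_optimal_def is_arg_min_def not_less)
  have opt: "(\<exists>ob u w. micp_optimal X T c g \<alpha>max N \<xi> \<epsilon> x ob \<alpha> u w) \<longleftrightarrow>
             drcc_optimal X T c g \<alpha>max D x \<alpha> \<and> T \<bullet> x \<le> \<xi> 0" for x \<alpha>
  proof -
    have "(\<exists>ob u w. micp_optimal X T c g \<alpha>max N \<xi> \<epsilon> x ob \<alpha> u w) \<longleftrightarrow>
        (\<exists>ob u w. micp_feasible X T \<alpha>max N \<xi> \<epsilon> x ob \<alpha> u w) \<and>
        (\<forall>y \<beta>. (\<exists>ob u w. micp_feasible X T \<alpha>max N \<xi> \<epsilon> y ob \<beta> u w)
            \<longrightarrow> risk_cost c g x \<alpha> \<le> risk_cost c g y \<beta>)"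
      unfolding micp_optimal_def is_arg_min_def split_paired_Ex split_paired_All prod.case not_ex
        de_Morgan_conj not_less imp_conv_disj
      by blast
    also have "\<dots> \<longleftrightarrow> (?D x \<alpha> \<and> T \<bullet> x \<le> \<xi> 0) \<and>
        (\<forall>y \<beta>. ?D y \<beta> \<and> T \<bullet> y \<le> \<xi> 0 \<longrightarrow> risk_cost c g x \<alpha> \<le> risk_cost c g y \<beta>)"
      unfolding feas ..
    also have "\<dots> \<longleftrightarrow> (?D x \<alpha> \<and> T \<bullet> x \<le> \<xi> 0) \<and>
        (\<forall>y \<beta>. ?D y \<beta> \<longrightarrow> risk_cost c g x \<alpha> \<le> risk_cost c g y \<beta>)"
      using best by (meson order_trans)
    also have "\<dots> \<longleftrightarrow> drcc_optimal X T c g \<alpha>max D x \<alpha> \<and> T \<bullet> x \<le> \<xi> 0"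
      by (auto simp: drcc_optimal_def is_arg_min_def not_less)
    finally show ?thesis .
  qed
  have "{ereal (risk_cost c g x \<alpha>) | x ob \<alpha> u w. micp_feasible X T \<alpha>max N \<xi> \<epsilon> x ob \<alpha> u w}
      = {ereal (risk_cost c g x \<alpha>) | x \<alpha>. ?D x \<alpha> \<and> T \<bullet> x \<le> \<xi> 0}"
    using feas by blast
  moreover have "Inf \<dots> = Inf {ereal (risk_cost c g x \<alpha>) | x \<alpha>. ?D x \<alpha>}"
  proof (rule antisym)
    show "Inf {ereal (risk_cost c g x \<alpha>) | x \<alpha>. ?D x \<alpha> \<and> T \<bullet> x \<le> \<xi> 0}
        \<le> Inf {ereal (risk_cost c g x \<alpha>) | x \<alpha>. ?D x \<alpha>}"
      by (rule Inf_mono) (use best in fastforce)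
  qed (rule Inf_superset_mono, blast)
  ultimately have "micp_value X T c g \<alpha>max N \<xi> \<epsilon> = drcc_value X T c g \<alpha>max D"
    by (simp add: micp_value_def drcc_value_def)
  with feas opt show ?thesis by blast
qed

end
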